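(* Let $p\ge 1$ be an integer, let $G$ be a graph with $\alpha(G)=r\ge 1$, and let $\Delta=\Delta(G)$ be its independence complex. The following are equivalent: (a) $G\in\mathbf W_p$; (b) $\Delta$ is pure and every ridge of $\Delta$ has degree at least $p$; (c) $G$ is well-covered and $|F_G(S)|\ge p$ for every independent set $S$ of $G$ with $|S|=r-1$.
   Context: All graphs are finite, simple and non-empty. $\Omega^*(G)$ denotes the family of independent sets of $G$, $\alpha(G)$ the independence number, and $\Omega(G)$ the family of maximum independent sets. $G$ is well-covered if every (inclusion-)maximal independent set has cardinality $\alpha(G)$. For an integer $p\ge1$, $G\in\mathbf W_p$ means: $|V(G)|\ge p$ and whenever $A_1,\dots,A_p\in\Omega^*(G)$ are pairwise disjoint, there exist pairwise disjoint $M_1,\dots,M_p\in\Omega(G)$ with $A_i\subseteq M_i$ for all $i$. The independence complex $\Delta(G)$ is the simplicial complex whose faces are the independent sets of $G$; it is pure if all its facets (inclusion-maximal faces) have the same cardinality. If $\Delta$ is pure with facets of cardinality $r$, a ridge is a face of cardinality $r-1$; the degree of a ridge $S$ is the number of vertices $x\notin S$ with $S\cup\{x\}\in\Delta$. For an independent set $S$ of $G$ with $|S|=\alpha(G)-1$, the fiber is $F_G(S)=\{x\in V(G)\setminus S: S\cup\{x\}\in\Omega(G)\}$. *)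

theory Defs
  imports "Graph_Theory.Pair_Digraph" "HOL-Library.Disjoint_Sets"
begin

text \<open>
  Finite simple graphs are the symmetric, loop-free, finite pair digraphs of \<open>Graph_Theory\<close>
  (locale \<open>pair_graph\<close>): an undirected edge is represented by its two orientations. That
  locale admits the empty graph, so non-emptiness is a separate assumption where needed.
\<close>

section \<open>Independent sets\<close>

definition indep_sets :: "'a pair_pre_digraph \<Rightarrow> 'a set set" where
  "indep_sets G = {S. S \<subseteq> pverts G \<and> (\<forall>u\<in>S. \<forall>v\<in>S. (u, v) \<notin> parcs G)}"

definition independence_number :: "'a pair_pre_digraph \<Rightarrow> nat" where
  "independence_number G = Max (card ` indep_sets G)"

definition maximum_indep_sets :: "'a pair_pre_digraph \<Rightarrow> 'a set set" where
  "maximum_indep_sets G = {S \<in> indep_sets G. card S = independence_number G}"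

definition maximal_indep_sets :: "'a pair_pre_digraph \<Rightarrow> 'a set set" where
  "maximal_indep_sets G = {S \<in> indep_sets G. \<forall>T\<in>indep_sets G. S \<subseteq> T \<longrightarrow> T = S}"

definition well_covered :: "'a pair_pre_digraph \<Rightarrow> bool" where
  "well_covered G \<longleftrightarrow> (\<forall>S\<in>maximal_indep_sets G. card S = independence_number G)"

text \<open>
  Pairwise disjointness refers to the family, not to its range: the empty set may occur several
  times among the \<open>A i\<close>.
\<close>

definition in_W :: "nat \<Rightarrow> 'a pair_pre_digraph \<Rightarrow> bool" where
  "in_W p G \<longleftrightarrow>
     p \<le> card (pverts G) \<and>
     (\<forall>A :: nat \<Rightarrow> 'a set.
        (\<forall>i\<in>{1..p}. A i \<in> indep_sets G) \<and> disjoint_family_on A {1..p} \<longrightarrow>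
        (\<exists>M :: nat \<Rightarrow> 'a set.
           (\<forall>i\<in>{1..p}. M i \<in> maximum_indep_sets G \<and> A i \<subseteq> M i) \<and>
           disjoint_family_on M {1..p}))"

definition fiber :: "'a pair_pre_digraph \<Rightarrow> 'a set \<Rightarrow> 'a set" where
  "fiber G S = {x \<in> pverts G - S. insert x S \<in> maximum_indep_sets G}"

section \<open>Simplicial complexes\<close>

text \<open>An abstract simplicial complex is given by its set of faces.\<close>

definition facets :: "'a set set \<Rightarrow> 'a set set" where
  "facets K = {F \<in> K. \<forall>T\<in>K. F \<subseteq> T \<longrightarrow> T = F}"

definition pure_complex :: "'a set set \<Rightarrow> bool" where
  "pure_complex K \<longleftrightarrow> (\<forall>F\<in>facets K. \<forall>F'\<in>facets K. card F = card F')"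

text \<open>
  Ridges are only meant for pure complexes, where the cardinality of the facet below does not
  depend on the choice of the facet. The equation avoids truncated subtraction.
\<close>

definition ridges :: "'a set set \<Rightarrow> 'a set set" where
  "ridges K = {S \<in> K. \<exists>F\<in>facets K. card F = card S + 1}"

definition ridge_degree :: "'a set set \<Rightarrow> 'a set \<Rightarrow> nat" where
  "ridge_degree K S = card {x \<in> \<Union>K. x \<notin> S \<and> insert x S \<in> K}"

definition independence_complex :: "'a pair_pre_digraph \<Rightarrow> 'a set set" where
  "independence_complex G = indep_sets G"

end

theory Submission
  imports Defs
begin

text \<open>
  The fiber of an independent set \<open>S\<close> of cardinality \<open>r - 1\<close> is a clique: two non-adjacent
  elements would extend \<open>S\<close> to an independent set of cardinality \<open>r + 1\<close>. If all fibers have at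
  least \<open>p\<close> elements and \<open>M\<^sub>1, \<dots>, M\<^sub>p\<close> are disjoint independent sets with
  \<open>card M\<^sub>i < r\<close>, enlarge \<open>M\<^sub>i\<close> to such an \<open>S\<close>. Each of the \<open>p - 1\<close> other members meets the
  clique at most once and \<open>M\<^sub>i\<close> misses it, so some element of the fiber is free and can be added
  to \<open>M\<^sub>i\<close>; iterate. Conversely, if a fiber has fewer than \<open>p\<close> elements, the family made of \<open>S\<close>
  and the singletons of its fiber admits no disjoint extension to maximum independent sets.
\<close>

section \<open>Independent sets and their extension to maximum ones\<close>

lemma finite_indep_sets: "finite (pverts G) \<Longrightarrow> finite (indep_sets G)"
  unfolding indep_sets_def by (rule finite_subset[of _ "Pow (pverts G)"]) auto

lemma finite_indep_set: "\<lbrakk>finite (pverts G); S \<in> indep_sets G\<rbrakk> \<Longrightarrow> finite S"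
  unfolding indep_sets_def by (auto intro: finite_subset)

lemma empty_indep_set: "{} \<in> indep_sets G"
  by (simp add: indep_sets_def)

lemma indep_sets_subset: "\<lbrakk>T \<in> indep_sets G; S \<subseteq> T\<rbrakk> \<Longrightarrow> S \<in> indep_sets G"
  unfolding indep_sets_def by blast

text \<open>Independence is a condition on pairs of vertices, and every pair from the enlarged set
  lies in one of the three given sets.\<close>

lemma indep_set_insert_insert:
  assumes "insert x S \<in> indep_sets G" "insert y S \<in> indep_sets G" "{x, y} \<in> indep_sets G"
  shows "insert x (insert y S) \<in> indep_sets G"
  using assms by (simp add: indep_sets_def)

lemma maximum_imp_indep: "S \<in> maximum_indep_sets G \<Longrightarrow> S \<in> indep_sets G"
  by (simp add: maximum_indep_sets_def)

lemma card_indep_set_le: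
  "\<lbrakk>finite (pverts G); S \<in> indep_sets G\<rbrakk> \<Longrightarrow> card S \<le> independence_number G"
  by (simp add: independence_number_def finite_indep_sets)

lemma obtain_maximum_indep_set:
  assumes "finite (pverts G)"
  obtains S where "S \<in> maximum_indep_sets G"
proof -
  have "independence_number G \<in> card ` indep_sets G"
    unfolding independence_number_def
    using finite_indep_sets[OF assms] empty_indep_set[of G] by (intro Max_in) auto
  then show ?thesis using that by (auto simp: maximum_indep_sets_def)
qed

lemma maximum_subset_maximal:
  assumes "finite (pverts G)"
  shows "maximum_indep_sets G \<subseteq> maximal_indep_sets G"
proof
  fix S assume S: "S \<in> maximum_indep_sets G"
  have "T = S" if "T \<in> indep_sets G" "S \<subseteq> T" for T
    using S card_seteq[OF finite_indep_set[OF assms that(1)] that(2)]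
      card_indep_set_le[OF assms that(1)]
    by (simp add: maximum_indep_sets_def)
  then show "S \<in> maximal_indep_sets G"
    using S by (auto simp: maximal_indep_sets_def maximum_indep_sets_def)
qed

lemma well_covered_extend:
  assumes "finite (pverts G)" "well_covered G" "S \<in> indep_sets G"
  obtains T where "T \<in> maximum_indep_sets G" "S \<subseteq> T"
proof -
  obtain T where T: "T \<in> indep_sets G" "S \<subseteq> T" "\<And>U. U \<in> indep_sets G \<Longrightarrow> T \<subseteq> U \<Longrightarrow> U = T"
    using finite_has_maximal2[OF finite_indep_sets[OF assms(1)] assms(3)] by metis
  then have "T \<in> maximal_indep_sets G" by (auto simp: maximal_indep_sets_def)
  then have "T \<in> maximum_indep_sets G"
    using assms(2) T(1) by (simp add: well_covered_def maximum_indep_sets_def)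
  then show ?thesis using that T(2) by blast
qed

text \<open>Non-adjacency is phrased as independence of \<open>{x, y}\<close>, so that the lemma
  says directly that an independent set meets a fiber at most once.\<close>

lemma fiber_clique:
  assumes fin: "finite (pverts G)" and "x \<in> fiber G S" "y \<in> fiber G S" "{x, y} \<in> indep_sets G"
  shows "x = y"
proof (rule ccontr)
  assume "x \<noteq> y"
  have ind: "insert x (insert y S) \<in> indep_sets G"
    by (rule indep_set_insert_insert) (use assms in \<open>simp_all add: fiber_def maximum_indep_sets_def\<close>)
  have "finite (insert y S)" using finite_indep_set[OF fin ind] by simp
  then have "card (insert x (insert y S)) = Suc (card (insert y S))"
    using \<open>x \<noteq> y\<close> assms(2) by (simp add: fiber_def)
  with card_indep_set_le[OF fin ind] assms(3) show False
    by (simp add: fiber_def maximum_indep_sets_def)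
qed

section \<open>From \<open>in_W\<close> to well-coveredness and large fibers\<close>

lemma in_W_extend:
  assumes "in_W p G" "\<And>i. i \<in> {1..p} \<Longrightarrow> A i \<in> indep_sets G" "disjoint_family_on A {1..p}"
  obtains M where "\<And>i. i \<in> {1..p} \<Longrightarrow> M i \<in> maximum_indep_sets G"
    and "\<And>i. i \<in> {1..p} \<Longrightarrow> A i \<subseteq> M i" and "disjoint_family_on M {1..p}"
proof -
  have "\<exists>M. (\<forall>i\<in>{1..p}. M i \<in> maximum_indep_sets G \<and> A i \<subseteq> M i) \<and>
          disjoint_family_on M {1..p}"
    by (rule assms(1)[unfolded in_W_def, THEN conjunct2, THEN spec[of _ A], THEN mp])
      (intro conjI ballI assms(2,3))
  then show ?thesis using that by blast
qed

text \<open>Pad a maximal independent set with empty sets to a disjoint family of \<open>p\<close>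
  members; the maximum set that contains it must equal it.\<close>

lemma in_W_imp_well_covered:
  assumes "p \<ge> 1" "in_W p G"
  shows "well_covered G"
  unfolding well_covered_def
proof
  fix S assume S: "S \<in> maximal_indep_sets G"
  define A where "A = (\<lambda>i::nat. if i = 1 then S else {})"
  have "A i \<in> indep_sets G" for i
    using S empty_indep_set[of G] by (simp add: A_def maximal_indep_sets_def)
  moreover have "disjoint_family_on A {1..p}"
    by (auto simp: A_def disjoint_family_on_def)
  ultimately obtain M where M: "\<And>i. i \<in> {1..p} \<Longrightarrow> M i \<in> maximum_indep_sets G"
      "\<And>i. i \<in> {1..p} \<Longrightarrow> A i \<subseteq> M i"
    using in_W_extend[OF assms(2), of A] by metis
  have "M 1 \<in> maximum_indep_sets G" "S \<subseteq> M 1"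
    using M[of 1] assms(1) by (simp_all add: A_def)
  with S show "card S = independence_number G"
    by (auto simp: maximal_indep_sets_def maximum_indep_sets_def)
qed

lemma in_W_imp_card_fiber:
  assumes fin: "finite (pverts G)" and "in_W p G"
    and S: "S \<in> indep_sets G" "Suc (card S) = independence_number G"
  shows "p \<le> card (fiber G S)"
proof (rule ccontr)
  assume "\<not> p \<le> card (fiber G S)"
  then have less: "card (fiber G S) < p" by simp
  define k where "k = card (fiber G S)"
  have finF: "finite (fiber G S)" using fin by (simp add: fiber_def)
  then obtain h where h: "bij_betw h {1..k} (fiber G S)"
    using ex_bij_betw_nat_finite_1 k_def by blast
  \<comment> \<open>Since \<open>k < p\<close>, index \<open>Suc k\<close> is still available for
    \<open>S\<close>; any later indices get the empty set.\<close>
  define A where "A = (\<lambda>i. if i \<in> {1..k} then {h i} else if i = Suc k then S else {})"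
  have h_fiber: "h i \<in> fiber G S" if "i \<in> {1..k}" for i
    using h that by (auto simp: bij_betw_def)
  have "{h i} \<in> indep_sets G" if "i \<in> {1..k}" for i
    using h_fiber[OF that] indep_sets_subset[of "insert (h i) S" G "{h i}"]
    by (simp add: fiber_def maximum_indep_sets_def)
  then have "A i \<in> indep_sets G" for i
    using S(1) empty_indep_set[of G] by (simp add: A_def)
  moreover have "A i \<inter> A j = {}" if "i \<noteq> j" for i j
  proof -
    have "h i \<notin> S" if "i \<in> {1..k}" for i using h_fiber[OF that] by (simp add: fiber_def)
    moreover have "h i \<noteq> h j" if "i \<in> {1..k}" "j \<in> {1..k}"
      using inj_on_eq_iff[OF bij_betw_imp_inj_on[OF h] that] \<open>i \<noteq> j\<close> by simp
    ultimately show ?thesis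
      using \<open>i \<noteq> j\<close> unfolding A_def by (auto simp del: atLeastAtMost_iff)
  qed
  then have "disjoint_family_on A {1..p}" by (simp add: disjoint_family_on_def)
  ultimately obtain M where M: "\<And>i. i \<in> {1..p} \<Longrightarrow> M i \<in> maximum_indep_sets G"
      "\<And>i. i \<in> {1..p} \<Longrightarrow> A i \<subseteq> M i" and disj: "disjoint_family_on M {1..p}"
    using in_W_extend[OF assms(2), of A] by metis
  have k_mem: "Suc k \<in> {1..p}" using less by (simp add: k_def)
  then have Mk: "M (Suc k) \<in> maximum_indep_sets G" and "S \<subseteq> M (Suc k)"
    using M[OF k_mem] by (simp_all add: A_def)
  moreover have "finite S" using finite_indep_set[OF fin S(1)] .
  moreover have "card S < card (M (Suc k))"
    using Mk S(2) by (auto simp: maximum_indep_sets_def)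
  then have "\<not> M (Suc k) \<subseteq> S" using card_mono[OF \<open>finite S\<close>] not_le by blast
  \<comment> \<open>This \<open>x\<close> will lie in the fiber, hence equal some
    \<open>h i\<close>, which \<open>M i\<close> already contains: a contradiction to
    disjointness.\<close>
  ultimately obtain x where x: "x \<in> M (Suc k)" "x \<notin> S" by blast
  have ind: "insert x S \<in> indep_sets G"
    by (rule indep_sets_subset[OF maximum_imp_indep[OF Mk]])
      (use x(1) \<open>S \<subseteq> M (Suc k)\<close> in simp)
  moreover have "card (insert x S) = independence_number G"
    using x(2) \<open>finite S\<close> S(2) by simp
  ultimately have "x \<in> fiber G S"
    using x(2) by (auto simp: fiber_def maximum_indep_sets_def indep_sets_def)
  then obtain i where i: "i \<in> {1..k}" "x = h i"
    using bij_betw_imp_surj_on[OF h] by blast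
  moreover from i have "i \<in> {1..p}" using less by (simp add: k_def)
  ultimately have "x \<in> M i" "i \<in> {1..p}" using M(2)[of i] by (simp_all add: A_def)
  moreover have "i \<noteq> Suc k" using i(1) by simp
  ultimately show False using disjoint_family_onD[OF disj _ k_mem] x(1) by blast
qed

section \<open>From large fibers to \<open>in_W\<close>\<close>

text \<open>The single augmentation step. Avoiding every member, \<open>A i\<close> included, keeps
  the family disjoint and makes \<open>A i\<close> strictly larger.\<close>

lemma extend_one:
  assumes fin: "finite (pverts G)" and wc: "well_covered G"
    and fib: "\<And>S. \<lbrakk>S \<in> indep_sets G; Suc (card S) = independence_number G\<rbrakk>
                \<Longrightarrow> card I \<le> card (fiber G S)"
    and I: "finite I" "i \<in> I"
    and A: "\<And>j. j \<in> I \<Longrightarrow> A j \<in> indep_sets G"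
    and less: "card (A i) < independence_number G"
  obtains x where "x \<notin> (\<Union>j\<in>I. A j)" "insert x (A i) \<in> indep_sets G"
proof -
  obtain T where T: "T \<in> maximum_indep_sets G" "A i \<subseteq> T"
    using well_covered_extend[OF fin wc A[OF I(2)]] .
  have finT: "finite T"
    using T(1) finite_indep_set[OF fin] by (auto simp: maximum_indep_sets_def)
  have "\<not> T \<subseteq> A i"
    using card_mono[OF finite_indep_set[OF fin A[OF I(2)]], of T] T(1) less
    by (auto simp: maximum_indep_sets_def)
  then obtain t where t: "t \<in> T" "t \<notin> A i" by blast
  \<comment> \<open>Removing an element outside \<open>A i\<close> from a maximum set leaves a set
    of the size required by \<open>fib\<close> that still contains \<open>A i\<close>.\<close>
  define S where "S = T - {t}"
  have S: "S \<in> indep_sets G" "A i \<subseteq> S"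
    using indep_sets_subset[OF maximum_imp_indep[OF T(1)]] T(2) t by (auto simp: S_def)
  have "Suc (card S) = independence_number G"
    using T(1) finT t(1) card_Suc_Diff1 by (fastforce simp: S_def maximum_indep_sets_def)
  then have card_F: "card I \<le> card (fiber G S)" using fib S(1) by blast
  have finF: "finite (fiber G S)" using fin by (simp add: fiber_def)
  have at_most_one: "card (fiber G S \<inter> A j) \<le> 1" if "j \<in> I" for j
  proof -
    have "x = y" if "x \<in> fiber G S \<inter> A j" "y \<in> fiber G S \<inter> A j" for x y
      using fiber_clique[OF fin, of x S y] that indep_sets_subset[OF A[OF \<open>j \<in> I\<close>], of "{x, y}"]
      by blast
    then show ?thesis using finF by (auto simp: card_le_Suc0_iff_eq)
  qed
  \<comment> \<open>Member \<open>i\<close> contributes nothing to the covered part of the fiber;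
    this gives the strict bound below \<open>card I\<close>.\<close>
  have "fiber G S \<inter> A i = {}" using S(2) by (auto simp: fiber_def)
  then have "fiber G S \<inter> (\<Union>j\<in>I. A j) = (\<Union>j\<in>I - {i}. fiber G S \<inter> A j)" by auto
  then have "card (fiber G S \<inter> (\<Union>j\<in>I. A j)) \<le> (\<Sum>j\<in>I - {i}. card (fiber G S \<inter> A j))"
    using I(1) by (simp only:) (intro card_UN_le, simp)
  also have "\<dots> \<le> (\<Sum>j\<in>I - {i}. 1)" using at_most_one by (intro sum_mono) auto
  also have "\<dots> < card I" using I card_Diff1_less by fastforce
  finally have "fiber G S \<inter> (\<Union>j\<in>I. A j) \<noteq> fiber G S" using card_F by auto
  then obtain x where x: "x \<in> fiber G S" "x \<notin> (\<Union>j\<in>I. A j)" by blast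
  have "insert x S \<in> indep_sets G" using x(1) by (simp add: fiber_def maximum_indep_sets_def)
  then have "insert x (A i) \<in> indep_sets G" by (rule indep_sets_subset) (use S(2) in auto)
  then show ?thesis using that x(2) by blast
qed

text \<open>Induction on the total deficiency, the sum of the amounts by which the members fall
  short of the independence number; each augmentation lowers it.\<close>

lemma extend_family:
  assumes fin: "finite (pverts G)" and wc: "well_covered G"
    and fib: "\<And>S. \<lbrakk>S \<in> indep_sets G; Suc (card S) = independence_number G\<rbrakk>
                \<Longrightarrow> card I \<le> card (fiber G S)"
    and I: "finite I"
    and "\<And>j. j \<in> I \<Longrightarrow> A j \<in> indep_sets G" "disjoint_family_on A I"
  shows "\<exists>M. (\<forall>j\<in>I. M j \<in> maximum_indep_sets G \<and> A j \<subseteq> M j) \<and> disjoint_family_on M I"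
  using assms(5,6)
proof (induction "\<Sum>j\<in>I. independence_number G - card (A j)" arbitrary: A rule: less_induct)
  case less
  show ?case
  proof (cases "\<exists>i\<in>I. card (A i) < independence_number G")
    case False
    then have "\<forall>j\<in>I. A j \<in> maximum_indep_sets G"
      using less.prems(1) card_indep_set_le[OF fin]
      by (fastforce simp: maximum_indep_sets_def)
    then show ?thesis using less.prems(2) by blast
  next
    case True
    then obtain i where i: "i \<in> I" "card (A i) < independence_number G" by blast
    obtain x where x: "x \<notin> (\<Union>j\<in>I. A j)" "insert x (A i) \<in> indep_sets G"
      using extend_one[where A = A, OF fin wc fib I i(1) less.prems(1) i(2)] .
    define B where "B = A(i := insert x (A i))"
    have "finite (A i)" using finite_indep_set[OF fin less.prems(1)[OF i(1)]] .
    then have card_B: "card (B i) = Suc (card (A i))"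
      using x(1) i(1) by (simp add: B_def)
    have "(\<Sum>j\<in>I. independence_number G - card (B j)) <
          (\<Sum>j\<in>I. independence_number G - card (A j))"
    proof (rule sum_strict_mono_ex1[OF I])
      show "\<forall>j\<in>I. independence_number G - card (B j) \<le> independence_number G - card (A j)"
        using card_B by (auto simp: B_def)
      show "\<exists>j\<in>I. independence_number G - card (B j) < independence_number G - card (A j)"
        using card_B i by (intro bexI[of _ i]) auto
    qed
    moreover have "\<And>j. j \<in> I \<Longrightarrow> B j \<in> indep_sets G"
      using less.prems(1) x(2) by (simp add: B_def)
    moreover have "disjoint_family_on B I"
      using less.prems(2) x(1) i(1) by (auto simp: B_def disjoint_family_on_def)
    ultimately obtain M where
      "\<forall>j\<in>I. M j \<in> maximum_indep_sets G \<and> B j \<subseteq> M j" "disjoint_family_on M I"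
      using less.hyps by blast
    moreover have "A j \<subseteq> B j" for j by (auto simp: B_def)
    ultimately show ?thesis by blast
  qed
qed

lemma in_W_iff_well_covered:
  assumes fin: "finite (pverts G)" and "p \<ge> 1" "independence_number G \<ge> 1"
  shows "in_W p G \<longleftrightarrow> well_covered G \<and>
    (\<forall>S\<in>indep_sets G. card S = independence_number G - 1 \<longrightarrow> p \<le> card (fiber G S))"
proof (intro iffI conjI ballI impI)
  assume "in_W p G"
  then show "well_covered G" using in_W_imp_well_covered assms(2) by blast
next
  fix S assume "in_W p G" "S \<in> indep_sets G" "card S = independence_number G - 1"
  then show "p \<le> card (fiber G S)"
    using in_W_imp_card_fiber[OF fin] assms(3) by simp
next
  assume "well_covered G \<and>
    (\<forall>S\<in>indep_sets G. card S = independence_number G - 1 \<longrightarrow> p \<le> card (fiber G S))"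
  then have wc: "well_covered G"
    and fib: "\<And>S. \<lbrakk>S \<in> indep_sets G; Suc (card S) = independence_number G\<rbrakk>
                \<Longrightarrow> card {1..p} \<le> card (fiber G S)"
    by auto
  \<comment> \<open>The bound \<open>p \<le> card (pverts G)\<close> comes from one fiber: a maximum
    independent set is nonempty, so deleting a vertex gives a set to which \<open>fib\<close>
    applies.\<close>
  obtain T where T: "T \<in> maximum_indep_sets G" using obtain_maximum_indep_set[OF fin] .
  then obtain t where t: "t \<in> T" using assms(3) by (fastforce simp: maximum_indep_sets_def)
  have "finite T" using T finite_indep_set[OF fin] by (auto simp: maximum_indep_sets_def)
  then have "Suc (card (T - {t})) = independence_number G"
    using T t card_Suc_Diff1 by (fastforce simp: maximum_indep_sets_def)
  moreover have "T - {t} \<in> indep_sets G"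
    using indep_sets_subset[OF maximum_imp_indep[OF T]] by blast
  ultimately have "p \<le> card (fiber G (T - {t}))" using fib by simp
  also have "\<dots> \<le> card (pverts G)" using fin by (intro card_mono) (auto simp: fiber_def)
  finally have "p \<le> card (pverts G)" .
  then show "in_W p G"
    unfolding in_W_def using extend_family[where I = "{1..p}", OF fin wc fib] by simp
qed

section \<open>Translation to the independence complex\<close>

lemma facets_indep_sets: "facets (indep_sets G) = maximal_indep_sets G"
  by (simp add: facets_def maximal_indep_sets_def)

text \<open>Some facet is a maximum independent set, so a common cardinality of all facets can only
  be the independence number.\<close>

lemma pure_iff_well_covered:
  assumes fin: "finite (pverts G)"
  shows "pure_complex (indep_sets G) \<longleftrightarrow> well_covered G"
proof -
  obtain T where "T \<in> maximum_indep_sets G" using obtain_maximum_indep_set[OF fin] .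
  then have "T \<in> maximal_indep_sets G" "card T = independence_number G"
    using maximum_subset_maximal[OF fin] by (auto simp: maximum_indep_sets_def)
  then show ?thesis
    unfolding pure_complex_def well_covered_def facets_indep_sets by metis
qed

lemma ridges_well_covered:
  assumes fin: "finite (pverts G)" and "well_covered G"
  shows "ridges (indep_sets G) = {S \<in> indep_sets G. Suc (card S) = independence_number G}"
proof -
  obtain T where "T \<in> maximum_indep_sets G" using obtain_maximum_indep_set[OF fin] .
  then have "T \<in> maximal_indep_sets G" "card T = independence_number G"
    using maximum_subset_maximal[OF fin] by (auto simp: maximum_indep_sets_def)
  then show ?thesis
    using assms(2) by (fastforce simp: ridges_def facets_indep_sets well_covered_def)
qed

text \<open>Adding a new vertex to \<open>S\<close> reaches the independence number, so the result
  is independent exactly when it is maximum.\<close>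

lemma ridge_degree_eq_card_fiber:
  assumes "finite (pverts G)" "S \<in> indep_sets G" "Suc (card S) = independence_number G"
  shows "ridge_degree (indep_sets G) S = card (fiber G S)"
proof -
  have "finite S" using assms finite_indep_set by blast
  then have "{x \<in> \<Union>(indep_sets G). x \<notin> S \<and> insert x S \<in> indep_sets G} = fiber G S"
    using assms(3) by (auto simp: fiber_def maximum_indep_sets_def indep_sets_def)
  then show ?thesis by (simp add: ridge_degree_def)
qed

theorem theorem3p1:
  fixes G :: "'a pair_pre_digraph" and p r :: nat and \<Delta> :: "'a set set"
  assumes "p \<ge> 1"
    and "pair_graph G"
    and "pverts G \<noteq> {}"
    and "independence_number G = r"
    and "r \<ge> 1"
    and "\<Delta> = independence_complex G"
  shows "(in_W p G \<longleftrightarrow>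
            pure_complex \<Delta> \<and> (\<forall>S\<in>ridges \<Delta>. ridge_degree \<Delta> S \<ge> p)) \<and>
         (in_W p G \<longleftrightarrow>
            well_covered G \<and> (\<forall>S\<in>indep_sets G. card S = r - 1 \<longrightarrow> card (fiber G S) \<ge> p))"
proof -
  interpret pair_graph G by fact
  have fin: "finite (pverts G)" by (rule pair_finite_verts)
  have c: "in_W p G \<longleftrightarrow>
      well_covered G \<and> (\<forall>S\<in>indep_sets G. card S = r - 1 \<longrightarrow> card (fiber G S) \<ge> p)"
    using in_W_iff_well_covered[OF fin] assms by blast
  \<comment> \<open>Comparing the two degree conditions under well-coveredness suffices, as purity
    is equivalent to it.\<close>
  have "(\<forall>S\<in>ridges \<Delta>. ridge_degree \<Delta> S \<ge> p) \<longleftrightarrow>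
      (\<forall>S\<in>indep_sets G. card S = r - 1 \<longrightarrow> card (fiber G S) \<ge> p)" if "well_covered G"
  proof -
    \<comment> \<open>Here \<open>r \<ge> 1\<close> keeps the subtraction from being
      truncated.\<close>
    have "card S = r - 1 \<longleftrightarrow> Suc (card S) = independence_number G" for S :: "'a set"
      using assms by auto
    then show ?thesis
      using assms(6) ridge_degree_eq_card_fiber[OF fin]
      by (auto simp: ridges_well_covered[OF fin that] independence_complex_def)
  qed
  then show ?thesis
    using c pure_iff_well_covered[OF fin] assms(6) by (auto simp: independence_complex_def)
qed

end
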